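(* (a) Let $(A,\circ)$ be a finite-dimensional Novikov algebra over $\mathbf{k}$, $(V,l_A,r_A)$ a finite-dimensional representation of $(A,\circ)$ and $T:V\to A$ an $\mathcal{O}$-operator associated to $(V,l_A,r_A)$. Then there exists a pre-Novikov algebra structure on $V$ defined by $$u\rhd v=l_A(T(u))v,\qquad u\lhd v=r_A(T(v))u\qquad\text{for all }u,v\in V.$$ (b) Let $(A,\lhd,\rhd)$ be a finite-dimensional pre-Novikov algebra and $(A,\circ)$ the associated Novikov algebra. Then the identity map on $A$ is an $\mathcal{O}$-operator of $(A,\circ)$ associated to the representation $(A,L_\rhd,R_\lhd)$.
   Context: $\mathbf{k}$ is a field of characteristic zero. A Novikov algebra $(A,\circ)$: $(a\circ b)\circ c-a\circ(b\circ c)=(b\circ a)\circ c-b\circ(a\circ c)$ and $(a\circ b)\circ c=(a\circ c)\circ b$. A representation $(V,l_A,r_A)$: linear maps $l_A,r_A:A\to\mathrm{End}_{\mathbf{k}}(V)$ with $l_A(a\circ b-b\circ a)=l_A(a)l_A(b)-l_A(b)l_A(a)$, $l_A(a)r_A(b)-r_A(b)l_A(a)=r_A(a\circ b)-r_A(b)r_A(a)$, $l_A(a\circ b)=r_A(b)l_A(a)$, $r_A(a)r_A(b)=r_A(b)r_A(a)$ for all $a,b\in A$. An $\mathcal{O}$-operator associated to $(V,l_A,r_A)$ is a linear map $T:V\to A$ with $T(u)\circ T(v)=T(l_A(T(u))v)+T(r_A(T(v))u)$ for all $u,v\in V$. A pre-Novikov algebra is a vector space $A$ with binary operations $\lhd,\rhd$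 such that for all $x,y,z\in A$: $x\rhd(y\rhd z)=(x\rhd y+x\lhd y)\rhd z+y\rhd(x\rhd z)-(y\rhd x+y\lhd x)\rhd z$; $x\rhd(y\lhd z)=(x\rhd y)\lhd z+y\lhd(x\lhd z+x\rhd z)-(y\lhd x)\lhd z$; $(x\lhd y+x\rhd y)\rhd z=(x\rhd z)\lhd y$; $(x\lhd y)\lhd z=(x\lhd z)\lhd y$. Its associated Novikov algebra is $(A,\circ)$ with $x\circ y=x\lhd y+x\rhd y$ (this is a Novikov algebra). With $L_\rhd(a)b=a\rhd b$ and $R_\lhd(a)b=b\lhd a$, $(A,L_\rhd,R_\lhd)$ is a representation of $(A,\circ)$. *)

theory Defs
  imports Complex_Main
begin

text \<open>Vector spaces over a field \<open>'k\<close> of characteristic zero are given by a scalar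
  multiplication satisfying the locale \<^locale>\<open>vector_space\<close>; the carrier is a whole type.\<close>

definition fin_dim :: "('k::field \<Rightarrow> 'a::ab_group_add \<Rightarrow> 'a) \<Rightarrow> bool" where
  "fin_dim scale \<longleftrightarrow> (\<exists>B. finite_dimensional_vector_space scale B)"

definition bilinear_map ::
  "('k::field \<Rightarrow> 'a::ab_group_add \<Rightarrow> 'a) \<Rightarrow> ('k \<Rightarrow> 'b::ab_group_add \<Rightarrow> 'b) \<Rightarrow>
   ('k \<Rightarrow> 'c::ab_group_add \<Rightarrow> 'c) \<Rightarrow> ('a \<Rightarrow> 'b \<Rightarrow> 'c) \<Rightarrow> bool" where
  "bilinear_map scaleA scaleB scaleC f \<longleftrightarrow>
     (\<forall>x. Vector_Spaces.linear scaleB scaleC (f x)) \<and>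
     (\<forall>y. Vector_Spaces.linear scaleA scaleC (\<lambda>x. f x y))"

locale novikov_algebra = vector_space scale
  for scale :: "'k::field_char_0 \<Rightarrow> 'a::ab_group_add \<Rightarrow> 'a" +
  fixes prod :: "'a \<Rightarrow> 'a \<Rightarrow> 'a"  (infixl \<open>\<odot>\<close> 70)
  assumes bilinear: "bilinear_map scale scale scale (\<odot>)"
    and left_symmetric: "(a \<odot> b) \<odot> c - a \<odot> (b \<odot> c) = (b \<odot> a) \<odot> c - b \<odot> (a \<odot> c)"
    and right_commutative: "(a \<odot> b) \<odot> c = (a \<odot> c) \<odot> b"

text \<open>A linear map from \<open>A\<close> to the endomorphisms of \<open>V\<close> is written as a curried function
  \<open>A \<Rightarrow> V \<Rightarrow> V\<close>; since the vector space structure on the endomorphisms is pointwise,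
  linearity of the map together with linearity of its values is bilinearity of the
  curried function.\<close>

locale novikov_representation =
  novikov_algebra scaleA prod + V: vector_space scaleV
  for scaleA :: "'k::field_char_0 \<Rightarrow> 'a::ab_group_add \<Rightarrow> 'a"
    and prod :: "'a \<Rightarrow> 'a \<Rightarrow> 'a"  (infixl \<open>\<odot>\<close> 70)
    and scaleV :: "'k \<Rightarrow> 'v::ab_group_add \<Rightarrow> 'v" +
  fixes l r :: "'a \<Rightarrow> 'v \<Rightarrow> 'v"
  assumes l_bilinear: "bilinear_map scaleA scaleV scaleV l"
    and r_bilinear: "bilinear_map scaleA scaleV scaleV r"
    and l_commutator: "l (a \<odot> b - b \<odot> a) v = l a (l b v) - l b (l a v)"
    and l_r_commutator: "l a (r b v) - r b (l a v) = r (a \<odot> b) v - r b (r a v)"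
    and l_prod: "l (a \<odot> b) v = r b (l a v)"
    and r_commute: "r a (r b v) = r b (r a v)"

locale O_operator =
  novikov_representation scaleA prod scaleV l r + T: Vector_Spaces.linear scaleV scaleA T
  for scaleA :: "'k::field_char_0 \<Rightarrow> 'a::ab_group_add \<Rightarrow> 'a"
    and prod :: "'a \<Rightarrow> 'a \<Rightarrow> 'a"  (infixl \<open>\<odot>\<close> 70)
    and scaleV :: "'k \<Rightarrow> 'v::ab_group_add \<Rightarrow> 'v"
    and l r :: "'a \<Rightarrow> 'v \<Rightarrow> 'v"
    and T :: "'v \<Rightarrow> 'a" +
  assumes O_identity: "T u \<odot> T v = T (l (T u) v) + T (r (T v) u)"

locale pre_novikov_algebra = vector_space scale
  for scale :: "'k::field_char_0 \<Rightarrow> 'a::ab_group_add \<Rightarrow> 'a" +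
  fixes lhd :: "'a \<Rightarrow> 'a \<Rightarrow> 'a"  (infixl \<open>\<lhd>\<close> 70)
    and rhd :: "'a \<Rightarrow> 'a \<Rightarrow> 'a"  (infixl \<open>\<rhd>\<close> 70)
  assumes lhd_bilinear: "bilinear_map scale scale scale (\<lhd>)"
    and rhd_bilinear: "bilinear_map scale scale scale (\<rhd>)"
    and rhd_rhd: "x \<rhd> (y \<rhd> z) =
      (x \<rhd> y + x \<lhd> y) \<rhd> z + y \<rhd> (x \<rhd> z) - (y \<rhd> x + y \<lhd> x) \<rhd> z"
    and rhd_lhd: "x \<rhd> (y \<lhd> z) =
      (x \<rhd> y) \<lhd> z + y \<lhd> (x \<lhd> z + x \<rhd> z) - (y \<lhd> x) \<lhd> z"
    and sum_rhd: "(x \<lhd> y + x \<rhd> y) \<rhd> z = (x \<rhd> z) \<lhd> y"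
    and lhd_lhd: "(x \<lhd> y) \<lhd> z = (x \<lhd> z) \<lhd> y"

definition associated_prod ::
  "('a \<Rightarrow> 'a \<Rightarrow> 'a) \<Rightarrow> ('a \<Rightarrow> 'a \<Rightarrow> 'a) \<Rightarrow> 'a::ab_group_add \<Rightarrow> 'a \<Rightarrow> 'a" where
  "associated_prod lhd rhd x y = lhd x y + rhd x y"

end

theory Submission imports Defs
begin

text \<open>Both parts rest on reading the four pre-Novikov identities as the four representation
  identities for left multiplication by \<open>\<rhd>\<close> and right multiplication by \<open>\<lhd>\<close>, with respect to
  the product \<open>x \<circ> y = x \<lhd> y + x \<rhd> y\<close>.

  Given an \<open>\<O>\<close>-operator \<open>T\<close>, its defining identity says \<open>T (u \<lhd> v + u \<rhd> v) = T u \<circ> T v\<close>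
  for the induced operations on \<open>V\<close>. Every sum of the two operations that occurs in a
  pre-Novikov identity is therefore turned by \<open>T\<close> into a product in \<open>A\<close>, and what remains
  is a representation identity evaluated at elements of the form \<open>T u\<close>.

  Conversely, for a pre-Novikov algebra the representation identities are the
  pre-Novikov identities themselves, and for the identity map the \<open>\<O>\<close>-operator identity is
  the definition of \<open>\<circ>\<close>. The computation left over is that \<open>\<circ>\<close> is a Novikov product.\<close>

lemma bilinear_map_flip:
  "bilinear_map sA sB sC f \<Longrightarrow> bilinear_map sB sA sC (\<lambda>b a. f a b)"
  by (simp add: bilinear_map_def)

lemma bilinear_map_comp_left:
  assumes "bilinear_map sA sB sC f" and "Vector_Spaces.linear sV sA T"
  shows "bilinear_map sV sB sC (\<lambda>u. f (T u))"
  using assms Vector_Spaces.linear_compose[OF assms(2)]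
  by (force simp: bilinear_map_def o_def)

lemma linear_plus:
  assumes "Vector_Spaces.linear s t p" and "Vector_Spaces.linear s t q"
  shows "Vector_Spaces.linear s t (\<lambda>x. p x + q x)"
proof -
  interpret p: Vector_Spaces.linear s t p by fact
  interpret vector_space_pair s t ..
  show ?thesis using assms by (rule linear_compose_add)
qed

lemma bilinear_map_plus:
  assumes "bilinear_map sA sB sC f" and "bilinear_map sA sB sC g"
  shows "bilinear_map sA sB sC (\<lambda>a b. f a b + g a b)"
  using assms by (simp add: bilinear_map_def linear_plus)

lemma bilinear_map_add_left:
  assumes "bilinear_map sA sB sC f"
  shows "f (a + b) v = f a v + f b v"
  using assms by (simp add: bilinear_map_def Vector_Spaces.linear_iff)

lemma bilinear_map_diff_left:
  assumes "bilinear_map sA sB sC f"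
  shows "f (a - b) v = f a v - f b v"
  using bilinear_map_add_left[OF assms, of "a - b" b v] by (simp add: algebra_simps)

lemma bilinear_map_add_right:
  assumes "bilinear_map sA sB sC f"
  shows "f a (u + v) = f a u + f a v"
  using assms by (simp add: bilinear_map_def Vector_Spaces.linear_iff)

text \<open>The \<open>\<O>\<close>-identity with its right-hand side collected under one \<open>T\<close>: in this direction
  it removes the sums of induced operations from the pre-Novikov identities on \<open>V\<close>.\<close>

lemma (in O_operator) T_induced_sum: "T (l (T u) v + r (T v) u) = T u \<odot> T v"
  by (simp add: T.add O_identity)

theorem (in O_operator) pre_novikov_of_O_operator:
  "pre_novikov_algebra scaleV (\<lambda>u v. r (T v) u) (\<lambda>u v. l (T u) v)"
proof
  show "bilinear_map scaleV scaleV scaleV (\<lambda>u v. r (T v) u)"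
    using bilinear_map_flip[OF bilinear_map_comp_left[OF r_bilinear T.linear_axioms]] .
  show "bilinear_map scaleV scaleV scaleV (\<lambda>u v. l (T u) v)"
    using bilinear_map_comp_left[OF l_bilinear T.linear_axioms] .
next
  fix x y z
  have sum': "T (r (T v) u + l (T u) v) = T u \<odot> T v" for u v
    using T_induced_sum by (simp add: add.commute)
  have "l (T x) (l (T y) z) - l (T y) (l (T x) z) = l (T x \<odot> T y) z - l (T y \<odot> T x) z"
    using l_commutator bilinear_map_diff_left[OF l_bilinear] by metis
  then show "l (T x) (l (T y) z) =
      l (T (l (T x) y + r (T y) x)) z + l (T y) (l (T x) z) - l (T (l (T y) x + r (T x) y)) z"
    unfolding T_induced_sum by (simp add: algebra_simps)
  show "l (T x) (r (T z) y) =
      r (T z) (l (T x) y) + r (T (r (T z) x + l (T x) z)) y - r (T z) (r (T x) y)"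
    unfolding sum' using l_r_commutator[of "T x" "T z" y] by (simp add: algebra_simps)
  show "l (T (r (T y) x + l (T x) y)) z = r (T y) (l (T x) z)"
    unfolding sum' by (rule l_prod)
  show "r (T z) (r (T y) x) = r (T y) (r (T z) x)"
    by (rule r_commute)
qed

context pre_novikov_algebra
begin

abbreviation circ (infixl \<open>\<circ>\<^sub>N\<close> 70)
  where "x \<circ>\<^sub>N y \<equiv> associated_prod (\<lhd>) (\<rhd>) x y"

lemma rhd_circ_commutator: "(x \<circ>\<^sub>N y) \<rhd> z - (y \<circ>\<^sub>N x) \<rhd> z = x \<rhd> (y \<rhd> z) - y \<rhd> (x \<rhd> z)"
  using rhd_rhd[of x y z] by (simp add: associated_prod_def algebra_simps)

lemma rhd_lhd_commutator: "x \<rhd> (y \<lhd> z) - (x \<rhd> y) \<lhd> z = y \<lhd> (x \<circ>\<^sub>N z) - (y \<lhd> x) \<lhd> z"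
  using rhd_lhd[of x y z] by (simp add: associated_prod_def algebra_simps)

lemma circ_rhd: "(x \<circ>\<^sub>N y) \<rhd> z = (x \<rhd> z) \<lhd> y"
  using sum_rhd by (simp add: associated_prod_def)

lemma circ_lhd: "(x \<circ>\<^sub>N y) \<lhd> z = (x \<lhd> y) \<lhd> z + (x \<rhd> y) \<lhd> z"
  by (simp add: associated_prod_def bilinear_map_add_left[OF lhd_bilinear])

text \<open>In \<open>(x \<circ> y) \<circ> z\<close> the term \<open>(x \<lhd> y) \<lhd> z\<close> is symmetric in \<open>y\<close> and \<open>z\<close>, and the term
  \<open>(x \<circ> y) \<rhd> z\<close> equals \<open>(x \<rhd> z) \<lhd> y\<close>, the mirror image of the remaining term \<open>(x \<rhd> y) \<lhd> z\<close>;
  this gives right commutativity. For left symmetry, the second pre-Novikov identity applied to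
  \<open>x \<rhd> (y \<lhd> z)\<close> brings the associator into a form in which every term is visibly symmetric in
  \<open>x\<close> and \<open>y\<close> except \<open>(x \<circ> y) \<rhd> z - x \<rhd> (y \<rhd> z)\<close>, whose symmetry is the first identity.\<close>

lemma novikov_associated_prod: "novikov_algebra scale (\<circ>\<^sub>N)"
proof
  show "bilinear_map scale scale scale (\<circ>\<^sub>N)"
    unfolding associated_prod_def[abs_def]
    by (rule bilinear_map_plus[OF lhd_bilinear rhd_bilinear])
next
  fix x y z
  have split: "a \<circ>\<^sub>N b = a \<lhd> b + a \<rhd> b" for a b
    by (simp add: associated_prod_def)
  have outer: "(a \<circ>\<^sub>N b) \<circ>\<^sub>N c = (a \<lhd> b) \<lhd> c + (a \<rhd> b) \<lhd> c + (a \<circ>\<^sub>N b) \<rhd> c" for a b c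
    using split[of "a \<circ>\<^sub>N b" c] by (simp only: circ_lhd)
  have inner: "a \<circ>\<^sub>N (b \<circ>\<^sub>N c) = a \<lhd> (b \<circ>\<^sub>N c) + a \<rhd> (b \<lhd> c) + a \<rhd> (b \<rhd> c)" for a b c
    using split[of a "b \<circ>\<^sub>N c"] bilinear_map_add_right[OF rhd_bilinear, of a "b \<lhd> c" "b \<rhd> c"]
    by (simp only: split[of b c] add.assoc)
  have "(x \<circ>\<^sub>N y) \<circ>\<^sub>N z = (x \<lhd> y) \<lhd> z + (x \<rhd> y) \<lhd> z + (x \<rhd> z) \<lhd> y"
    by (simp only: outer circ_rhd)
  moreover have "(x \<circ>\<^sub>N z) \<circ>\<^sub>N y = (x \<lhd> z) \<lhd> y + (x \<rhd> z) \<lhd> y + (x \<rhd> y) \<lhd> z"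
    by (simp only: outer circ_rhd)
  ultimately show "(x \<circ>\<^sub>N y) \<circ>\<^sub>N z = (x \<circ>\<^sub>N z) \<circ>\<^sub>N y"
    using lhd_lhd[of x y z] by simp
  have assoc: "(a \<circ>\<^sub>N b) \<circ>\<^sub>N c - a \<circ>\<^sub>N (b \<circ>\<^sub>N c) =
      (a \<lhd> b) \<lhd> c + (b \<lhd> a) \<lhd> c - a \<lhd> (b \<circ>\<^sub>N c) - b \<lhd> (a \<circ>\<^sub>N c)
      + ((a \<circ>\<^sub>N b) \<rhd> c - a \<rhd> (b \<rhd> c))" for a b c
    using rhd_lhd_commutator[of a b c] unfolding outer inner
    by (simp add: algebra_simps)
  have "(x \<circ>\<^sub>N y) \<rhd> z - x \<rhd> (y \<rhd> z) = (y \<circ>\<^sub>N x) \<rhd> z - y \<rhd> (x \<rhd> z)"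
    using rhd_circ_commutator[of x y z] by (simp add: algebra_simps)
  then show "(x \<circ>\<^sub>N y) \<circ>\<^sub>N z - x \<circ>\<^sub>N (y \<circ>\<^sub>N z) = (y \<circ>\<^sub>N x) \<circ>\<^sub>N z - y \<circ>\<^sub>N (x \<circ>\<^sub>N z)"
    unfolding assoc by (simp add: algebra_simps)
qed

theorem O_operator_id: "O_operator scale (\<circ>\<^sub>N) scale (\<lambda>a b. a \<rhd> b) (\<lambda>a b. b \<lhd> a) id"
proof -
  interpret N: novikov_algebra scale "(\<circ>\<^sub>N)"
    by (rule novikov_associated_prod)
  show ?thesis
  proof
    show "bilinear_map scale scale scale (\<lambda>a b. a \<rhd> b)"
      by (rule rhd_bilinear)
    show "bilinear_map scale scale scale (\<lambda>a b. b \<lhd> a)"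
      by (rule bilinear_map_flip[OF lhd_bilinear])
    fix a b v
    show "(a \<circ>\<^sub>N b - b \<circ>\<^sub>N a) \<rhd> v = a \<rhd> (b \<rhd> v) - b \<rhd> (a \<rhd> v)"
      by (simp only: bilinear_map_diff_left[OF rhd_bilinear] rhd_circ_commutator)
    show "a \<rhd> (v \<lhd> b) - (a \<rhd> v) \<lhd> b = v \<lhd> (a \<circ>\<^sub>N b) - (v \<lhd> a) \<lhd> b"
      by (rule rhd_lhd_commutator)
    show "(a \<circ>\<^sub>N b) \<rhd> v = (a \<rhd> v) \<lhd> b"
      by (rule circ_rhd)
    show "(v \<lhd> b) \<lhd> a = (v \<lhd> a) \<lhd> b"
      by (rule lhd_lhd)
  qed (simp_all add: associated_prod_def add.commute)
qed

end

theorem proposition3p34: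
  fixes scaleA :: "'k::field_char_0 \<Rightarrow> 'a::ab_group_add \<Rightarrow> 'a"
    and prod :: "'a \<Rightarrow> 'a \<Rightarrow> 'a"
    and scaleV :: "'k \<Rightarrow> 'v::ab_group_add \<Rightarrow> 'v"
    and l r :: "'a \<Rightarrow> 'v \<Rightarrow> 'v"
    and T :: "'v \<Rightarrow> 'a"
    and scaleB :: "'k \<Rightarrow> 'b::ab_group_add \<Rightarrow> 'b"
    and lhd rhd :: "'b \<Rightarrow> 'b \<Rightarrow> 'b"
  shows
    "(novikov_algebra scaleA prod \<and> fin_dim scaleA \<and>
      novikov_representation scaleA prod scaleV l r \<and> fin_dim scaleV \<and>
      O_operator scaleA prod scaleV l r T
      \<longrightarrow> pre_novikov_algebra scaleV (\<lambda>u v. r (T v) u) (\<lambda>u v. l (T u) v))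
     \<and>
     (pre_novikov_algebra scaleB lhd rhd \<and> fin_dim scaleB
      \<longrightarrow> O_operator scaleB (associated_prod lhd rhd) scaleB
            (\<lambda>a b. rhd a b) (\<lambda>a b. lhd b a) id)"
proof (intro conjI impI)
  assume "novikov_algebra scaleA prod \<and> fin_dim scaleA \<and>
      novikov_representation scaleA prod scaleV l r \<and> fin_dim scaleV \<and>
      O_operator scaleA prod scaleV l r T"
  then show "pre_novikov_algebra scaleV (\<lambda>u v. r (T v) u) (\<lambda>u v. l (T u) v)"
    by (blast intro: O_operator.pre_novikov_of_O_operator)
next
  assume "pre_novikov_algebra scaleB lhd rhd \<and> fin_dim scaleB"
  then show "O_operator scaleB (associated_prod lhd rhd) scaleB
      (\<lambda>a b. rhd a b) (\<lambda>a b. lhd b a) id"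
    by (blast intro: pre_novikov_algebra.O_operator_id)
qed

end
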